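(* Let $1\leq p<\infty$ and $k\in\mathbb{N}$ with $k\geq p$. Then there exists a non-homogeneous polynomial $P\in\mathcal{P}^{k+1}(\ell_p;\mathbb{C})$ such that $P\in\operatorname{NA}_v\mathcal{P}^{k+1}(\ell_p;\mathbb{C})$ but $P\notin\operatorname{NA}\mathcal{P}^{k+1}(\ell_p;\mathbb{C})$.
   Context: $\ell_p$ is the complex sequence space. For a complex Banach space $X$, $B_X$ is the open unit ball and $\overline{B_X}$ the closed unit ball. $\mathcal{P}^N(X;\mathbb{C})$ is the space of (continuous) polynomials $P=\sum_{k=0}^NP_k$ of degree at most $N$, with $P_k$ a continuous $k$-homogeneous polynomial. $\|P\|_\infty=\sup_{x\in B_X}|P(x)|$ and $\|P\|_v=\sup_{x\in B_X}(1-\|x\|^2)|P(x)|$. $\operatorname{NA}\mathcal{P}^N(X;\mathbb{C})$ is the set of $P\in\mathcal{P}^N(X;\mathbb{C})$ for which there is $x_0\in\overline{B_X}$ with $|P(x_0)|=\|P\|_\infty$; $\operatorname{NA}_v\mathcal{P}^N(X;\mathbb{C})$ is the set of $P\in\mathcal{P}^N(X;\mathbb{C})$ for which there is $x_0\in\overline{B_X}$ with $(1-\|x_0\|^2)|P(x_0)|=\|P\|_v$. *)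

theory Defs
  imports "HOL-Analysis.Analysis"
begin

section \<open>The complex sequence space \<open>\<ell>\<^sub>p\<close>, for real \<open>p \<ge> 1\<close>\<close>

definition lp :: "real \<Rightarrow> (nat \<Rightarrow> complex) set" where
  "lp p = {x. summable (\<lambda>n. cmod (x n) powr p)}"

definition lp_norm :: "real \<Rightarrow> (nat \<Rightarrow> complex) \<Rightarrow> real" where
  "lp_norm p x = (\<Sum>n. cmod (x n) powr p) powr (1 / p)"

definition lp_dist :: "real \<Rightarrow> (nat \<Rightarrow> complex) \<Rightarrow> (nat \<Rightarrow> complex) \<Rightarrow> real" where
  "lp_dist p x y = lp_norm p (\<lambda>n. x n - y n)"

definition lp_topology :: "real \<Rightarrow> (nat \<Rightarrow> complex) topology" where
  "lp_topology p = Metric_space.mtopology (lp p) (lp_dist p)"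

definition lp_ball :: "real \<Rightarrow> (nat \<Rightarrow> complex) set" where
  "lp_ball p = {x \<in> lp p. lp_norm p x < 1}"

definition lp_cball :: "real \<Rightarrow> (nat \<Rightarrow> complex) set" where
  "lp_cball p = {x \<in> lp p. lp_norm p x \<le> 1}"

lemma lp_norm_nonneg: "0 \<le> lp_norm p x"
  by (simp add: lp_norm_def)

lemma lp_norm_powr:
  assumes "1 \<le> p" "x \<in> lp p"
  shows "lp_norm p x powr p = (\<Sum>n. cmod (x n) powr p)"
proof -
  have "0 \<le> (\<Sum>n. cmod (x n) powr p)"
    using assms(2) by (intro suminf_nonneg) (auto simp: lp_def)
  then show ?thesis
    using assms(1) by (simp add: lp_norm_def powr_powr)
qed

lemma lp_norm_eq_0_iff:
  assumes "1 \<le> p" "x \<in> lp p"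
  shows "lp_norm p x = 0 \<longleftrightarrow> (\<forall>n. x n = 0)"
proof -
  have "lp_norm p x = 0 \<longleftrightarrow> (\<Sum>n. cmod (x n) powr p) = 0"
    by (simp add: lp_norm_def)
  also have "\<dots> \<longleftrightarrow> (\<forall>n. cmod (x n) powr p = 0)"
    using assms(2) by (intro suminf_eq_zero_iff) (auto simp: lp_def)
  finally show ?thesis by simp
qed

lemma powr_convex_nonneg:
  fixes a b t p :: real
  assumes "1 \<le> p" "0 \<le> a" "0 \<le> b" "0 < t" "t < 1"
  shows "((1 - t) * a + t * b) powr p \<le> (1 - t) * a powr p + t * b powr p"
proof -
  have shrink: "(s * c) powr p \<le> s * c powr p" if "0 < s" "s < 1" "0 \<le> c" for s c :: real
  proof -
    have "s powr p \<le> s powr 1"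
      using that assms(1) by (intro powr_mono') auto
    then show ?thesis
      using that by (simp add: powr_mult mult_right_mono)
  qed
  consider "a = 0" | "b = 0" | "a > 0" "b > 0"
    using assms by linarith
  then show ?thesis
  proof cases
    case 1
    then show ?thesis using shrink[of t b] assms by simp
  next
    case 2
    then show ?thesis using shrink[of "1 - t" a] assms by simp
  next
    case 3
    then show ?thesis
      using convex_onD[OF powr_convex[OF assms(1)], of t a b] assms by simp
  qed
qed

lemma lp_add:
  assumes p: "1 \<le> p" and x: "x \<in> lp p" and y: "y \<in> lp p"
  shows "(\<lambda>n. x n + y n) \<in> lp p"
    and "lp_norm p (\<lambda>n. x n + y n) \<le> lp_norm p x + lp_norm p y"
proof -
  have "(\<lambda>n. x n + y n) \<in> lp p \<and>
        lp_norm p (\<lambda>n. x n + y n) \<le> lp_norm p x + lp_norm p y"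
  proof (cases "lp_norm p x = 0 \<or> lp_norm p y = 0")
    case True
    then have "(\<forall>n. x n = 0) \<or> (\<forall>n. y n = 0)"
      using lp_norm_eq_0_iff p x y by blast
    then show ?thesis
      using x y lp_norm_nonneg[of p] by auto
  next
    case False
    define a where "a = lp_norm p x"
    define b where "b = lp_norm p y"
    have a: "a > 0" and b: "b > 0"
      using False lp_norm_nonneg[of p x] lp_norm_nonneg[of p y] by (auto simp: a_def b_def)
    define t where "t = b / (a + b)"
    have t: "0 < t" "t < 1" and t': "1 - t = a / (a + b)"
      using a b by (auto simp: t_def field_simps)
    define F where "F n = (a + b) powr p *
      ((1 - t) * (cmod (x n) powr p / a powr p) + t * (cmod (y n) powr p / b powr p))" for n
    have le: "cmod (x n + y n) powr p \<le> F n" for n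
    proof -
      have "cmod (x n + y n) \<le> cmod (x n) + cmod (y n)"
        by (rule norm_triangle_ineq)
      also have "\<dots> = (a + b) * ((1 - t) * (cmod (x n) / a) + t * (cmod (y n) / b))"
        unfolding t' unfolding t_def distrib_left using a b by simp
      finally have "cmod (x n + y n) powr p \<le>
          ((a + b) * ((1 - t) * (cmod (x n) / a) + t * (cmod (y n) / b))) powr p"
        using p by (intro powr_mono2) auto
      also have "\<dots> = (a + b) powr p * ((1 - t) * (cmod (x n) / a) + t * (cmod (y n) / b)) powr p"
        using a b t by (intro powr_mult)
      also have "\<dots> \<le> F n"
      proof -
        have "((1 - t) * (cmod (x n) / a) + t * (cmod (y n) / b)) powr p
            \<le> (1 - t) * (cmod (x n) / a) powr p + t * (cmod (y n) / b) powr p"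
          using a b t p by (intro powr_convex_nonneg) auto
        then show ?thesis
          unfolding F_def using a b by (intro mult_left_mono) (auto simp: powr_divide)
      qed
      finally show ?thesis .
    qed
    have sx: "(\<lambda>n. cmod (x n) powr p) sums (a powr p)"
      using x lp_norm_powr[OF p x] by (simp add: a_def lp_def summable_sums)
    have sy: "(\<lambda>n. cmod (y n) powr p) sums (b powr p)"
      using y lp_norm_powr[OF p y] by (simp add: b_def lp_def summable_sums)
    have "F sums ((a + b) powr p * ((1 - t) * (a powr p / a powr p) + t * (b powr p / b powr p)))"
      unfolding F_def by (intro sums_mult sums_add sums_divide sx sy)
    then have F: "F sums ((a + b) powr p)"
      using a b by simp
    have s: "summable (\<lambda>n. cmod (x n + y n) powr p)"
      using sums_summable[OF F] le by (rule_tac summable_comparison_test') auto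
    have "(\<Sum>n. cmod (x n + y n) powr p) \<le> (a + b) powr p"
      using suminf_le[OF le s sums_summable[OF F]] sums_unique[OF F] by simp
    then have "lp_norm p (\<lambda>n. x n + y n) \<le> ((a + b) powr p) powr (1 / p)"
      unfolding lp_norm_def using p s by (intro powr_mono2 suminf_nonneg) auto
    also have "\<dots> = a + b"
      using a b p by (simp add: powr_powr)
    finally show ?thesis
      using s by (simp add: lp_def a_def b_def)
  qed
  then show "(\<lambda>n. x n + y n) \<in> lp p"
    and "lp_norm p (\<lambda>n. x n + y n) \<le> lp_norm p x + lp_norm p y" by auto
qed

lemma lp_scale:
  assumes "1 \<le> p" "x \<in> lp p"
  shows "(\<lambda>n. c * x n) \<in> lp p"
    and "lp_norm p (\<lambda>n. c * x n) = cmod c * lp_norm p x"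
proof -
  have s: "summable (\<lambda>n. cmod (x n) powr p)"
    using assms(2) by (simp add: lp_def)
  then show "(\<lambda>n. c * x n) \<in> lp p"
    by (simp add: lp_def norm_mult powr_mult summable_mult)
  have "0 \<le> (\<Sum>n. cmod (x n) powr p)"
    using s by (intro suminf_nonneg) auto
  then show "lp_norm p (\<lambda>n. c * x n) = cmod c * lp_norm p x"
    using assms(1) s by (simp add: lp_norm_def norm_mult powr_mult suminf_mult powr_powr)
qed

lemma lp_diff:
  assumes "1 \<le> p" "x \<in> lp p" "y \<in> lp p"
  shows "(\<lambda>n. x n - y n) \<in> lp p"
  using lp_add(1)[OF assms(1,2) lp_scale(1)[OF assms(1,3), of "-1"]] by simp

lemma Metric_space_lp:
  assumes p: "1 \<le> p"
  shows "Metric_space (lp p) (lp_dist p)"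
proof
  show "0 \<le> lp_dist p x y" for x y
    by (simp add: lp_dist_def lp_norm_nonneg)
  show "lp_dist p x y = lp_dist p y x" for x y
    by (simp add: lp_dist_def lp_norm_def norm_minus_commute)
  show "lp_dist p x y = 0 \<longleftrightarrow> x = y" if "x \<in> lp p" "y \<in> lp p" for x y
    using lp_norm_eq_0_iff[OF p lp_diff[OF p that]] by (auto simp: lp_dist_def)
  show "lp_dist p x z \<le> lp_dist p x y + lp_dist p y z"
    if "x \<in> lp p" "y \<in> lp p" "z \<in> lp p" for x y z
    using lp_add(2)[OF p lp_diff[OF p that(1,2)] lp_diff[OF p that(2,3)]]
    by (simp add: lp_dist_def)
qed

section \<open>Continuous polynomials on \<open>\<ell>\<^sub>p\<close>\<close>

text \<open>
  Functions on \<open>\<ell>\<^sub>p\<close> are total functions on sequences; every notion below depends only on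
  their values on \<open>lp p\<close>.  An \<open>m\<close>-tuple of vectors is an element of
  \<open>{..<m} \<rightarrow>\<^sub>E lp p\<close>; for \<open>m = 0\<close> there is exactly one, so that the \<open>0\<close>-homogeneous
  polynomials are the constants.
\<close>

definition multilinear_lp :: "real \<Rightarrow> nat \<Rightarrow> ((nat \<Rightarrow> nat \<Rightarrow> complex) \<Rightarrow> complex) \<Rightarrow> bool" where
  "multilinear_lp p m L \<longleftrightarrow>
     (\<forall>X \<in> {..<m} \<rightarrow>\<^sub>E lp p. \<forall>i<m. \<forall>y \<in> lp p. \<forall>z \<in> lp p. \<forall>a b.
        L (X(i := (\<lambda>n. a * y n + b * z n))) = a * L (X(i := y)) + b * L (X(i := z)))"

definition homog_poly_lp :: "real \<Rightarrow> nat \<Rightarrow> ((nat \<Rightarrow> complex) \<Rightarrow> complex) set" where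
  "homog_poly_lp p m = {P. continuous_map (lp_topology p) euclidean P \<and>
     (\<exists>L. multilinear_lp p m L \<and> (\<forall>x \<in> lp p. P x = L (\<lambda>i\<in>{..<m}. x)))}"

definition poly_lp :: "real \<Rightarrow> nat \<Rightarrow> ((nat \<Rightarrow> complex) \<Rightarrow> complex) set" where
  "poly_lp p N = {P. \<exists>Q. (\<forall>m\<le>N. Q m \<in> homog_poly_lp p m) \<and>
     (\<forall>x \<in> lp p. P x = (\<Sum>m\<le>N. Q m x))}"

section \<open>Norms and norm attainment\<close>

text \<open>
  Continuous polynomials are bounded on the unit ball, so for \<open>P\<close> in \<open>poly_lp p N\<close> and
  \<open>1 \<le> p\<close> the real-valued suprema below range over nonempty bounded sets.
\<close>

definition sup_norm :: "real \<Rightarrow> ((nat \<Rightarrow> complex) \<Rightarrow> complex) \<Rightarrow> real" where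
  "sup_norm p P = (SUP x\<in>lp_ball p. cmod (P x))"

definition v_norm :: "real \<Rightarrow> ((nat \<Rightarrow> complex) \<Rightarrow> complex) \<Rightarrow> real" where
  "v_norm p P = (SUP x\<in>lp_ball p. (1 - (lp_norm p x)\<^sup>2) * cmod (P x))"

definition NA :: "real \<Rightarrow> nat \<Rightarrow> ((nat \<Rightarrow> complex) \<Rightarrow> complex) set" where
  "NA p N = {P \<in> poly_lp p N. \<exists>x\<^sub>0 \<in> lp_cball p. cmod (P x\<^sub>0) = sup_norm p P}"

definition NA_v :: "real \<Rightarrow> nat \<Rightarrow> ((nat \<Rightarrow> complex) \<Rightarrow> complex) set" where
  "NA_v p N = {P \<in> poly_lp p N.
     \<exists>x\<^sub>0 \<in> lp_cball p. (1 - (lp_norm p x\<^sub>0)\<^sup>2) * cmod (P x\<^sub>0) = v_norm p P}"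

end

theory Submission
  imports Defs
begin

text \<open>
  The polynomial is \<open>P x = 1 + (\<Sum>n. n / (n + 1) * x n ^ (k + 1))\<close>. With \<open>r = \<parallel>x\<parallel>\<close>
  the sum is at most \<open>r ^ (k + 1) \<le> r\<^sup>2\<close> in modulus, so the weighted modulus is at most
  \<open>(1 - r\<^sup>2) * (1 + r\<^sup>2) \<le> 1\<close>, a bound attained at the origin. The supremum of \<open>\<bar>P\<bar>\<close> is \<open>2\<close>,
  approached along multiples of the unit vectors, but since all coefficients are strictly
  below \<open>1\<close> it is not attained.
\<close>

section \<open>Power sums on \<open>lp p\<close> and elementary inequalities\<close>

lemma lp_coord_le_norm:
  assumes "1 \<le> p" "x \<in> lp p"
  shows "cmod (x n) \<le> lp_norm p x"
proof -
  have "cmod (x n) powr p \<le> (\<Sum>i. cmod (x i) powr p)"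
    using sum_le_suminf[of "\<lambda>i. cmod (x i) powr p" "{n}"] assms(2) by (simp add: lp_def)
  then have "(cmod (x n) powr p) powr (1 / p) \<le> lp_norm p x"
    unfolding lp_norm_def using assms(1) by (intro powr_mono2) auto
  then show ?thesis using assms(1) by (simp add: powr_powr)
qed

text \<open>Every coordinate is at most \<open>r = lp_norm p x\<close> in modulus, so
  \<open>cmod (x n) ^ K\<close> splits off the factor \<open>r powr (K - p)\<close> and leaves
  \<open>cmod (x n) powr p\<close>, whose sum is \<open>r powr p\<close>. This is the norm-one
  inclusion of the \<open>p\<close>-space in the \<open>K\<close>-space.\<close>

lemma lp_power_sum:
  assumes p: "1 \<le> p" and x: "x \<in> lp p" and K: "p \<le> real K"
  shows "summable (\<lambda>n. cmod (x n) ^ K)"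
    and "(\<Sum>n. cmod (x n) ^ K) \<le> lp_norm p x ^ K"
proof -
  define r where "r = lp_norm p x"
  have r: "0 \<le> r" by (simp add: r_def lp_norm_nonneg)
  have le: "cmod (x n) ^ K \<le> r powr (real K - p) * cmod (x n) powr p" for n
  \<comment> \<open>Converting between \<open>^\<close> and \<open>powr\<close> requires a positive
    base. At zero both sides vanish because \<open>K\<close> is positive.\<close>
  proof (cases "x n = 0")
    case True
    then show ?thesis using p K by (auto simp: power_0_left)
  next
    case False
    have "cmod (x n) ^ K = cmod (x n) powr (real K - p) * cmod (x n) powr p"
      using False by (simp add: powr_add[symmetric] powr_realpow)
    also have "\<dots> \<le> r powr (real K - p) * cmod (x n) powr p"
      using K lp_coord_le_norm[OF p x] by (intro mult_right_mono powr_mono2) (auto simp: r_def)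
    finally show ?thesis .
  qed
  have s: "summable (\<lambda>n. cmod (x n) powr p)"
    using x by (simp add: lp_def)
  then have s': "summable (\<lambda>n. r powr (real K - p) * cmod (x n) powr p)"
    by (rule summable_mult)
  show summ: "summable (\<lambda>n. cmod (x n) ^ K)"
    by (rule summable_comparison_test'[OF s']) (use le in auto)
  have "(\<Sum>n. cmod (x n) ^ K) \<le> r powr (real K - p) * (\<Sum>n. cmod (x n) powr p)"
    using suminf_le[OF le summ s'] s by (simp add: suminf_mult)
  also have "\<dots> = r powr real K"
    unfolding lp_norm_powr[OF p x, symmetric] by (simp add: r_def flip: powr_add)
  also have "\<dots> = r ^ K"
    using r p K by (cases "r = 0") (auto simp: powr_realpow)
  finally show "(\<Sum>n. cmod (x n) ^ K) \<le> lp_norm p x ^ K"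
    by (simp add: r_def)
qed

text \<open>Replacing every factor by the largest one, \<open>f j\<close>, gives
  \<open>f j ^ m\<close>, which is one of the summands. This crude form of AM-GM suffices for
  summability; at \<open>m = 0\<close> the empty product 1 would exceed the empty sum.\<close>

lemma prod_le_sum_power:
  fixes f :: "nat \<Rightarrow> real"
  assumes "\<And>i. i < m \<Longrightarrow> 0 \<le> f i" "0 < m"
  shows "(\<Prod>i<m. f i) \<le> (\<Sum>i<m. f i ^ m)"
proof -
  have "Max (f ` {..<m}) \<in> f ` {..<m}"
    using assms(2) by (intro Max_in) auto
  then obtain j where j: "j < m" "Max (f ` {..<m}) = f j" by auto
  have "f i \<le> f j" if "i < m" for i
    unfolding j(2)[symmetric] using that by (intro Max_ge) auto
  then have "(\<Prod>i<m. f i) \<le> (\<Prod>i<m. f j)"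
    using assms(1) by (intro prod_mono) auto
  also have "\<dots> = f j ^ m" by simp
  also have "\<dots> \<le> (\<Sum>i<m. f i ^ m)"
    using j(1) assms(1) by (intro member_le_sum) auto
  finally show ?thesis .
qed

lemma norm_power_diff_le:
  fixes a b :: "'a :: {real_normed_algebra_1, comm_ring_1}"
  shows "norm (a ^ Suc m - b ^ Suc m) \<le> real (Suc m) * (norm (a - b) * (norm a + norm b) ^ m)"
proof (induction m)
  case (Suc m)
  have "a ^ Suc (Suc m) - b ^ Suc (Suc m) = a * (a ^ Suc m - b ^ Suc m) + (a - b) * b ^ Suc m"
    by (simp add: algebra_simps)
  also have "norm \<dots> \<le> norm a * norm (a ^ Suc m - b ^ Suc m) + norm (a - b) * norm b ^ Suc m"
    by (intro norm_triangle_le add_mono norm_mult_ineq[THEN order_trans] mult_left_mono norm_power_ineq) auto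
  also have "\<dots> \<le> (norm a + norm b) * (real (Suc m) * (norm (a - b) * (norm a + norm b) ^ m))
      + norm (a - b) * (norm a + norm b) ^ Suc m"
    by (intro add_mono mult_mono mult_left_mono power_mono Suc.IH) auto
  also have "\<dots> = real (Suc (Suc m)) * (norm (a - b) * (norm a + norm b) ^ Suc m)"
    by (simp add: algebra_simps)
  finally show ?case .
qed simp

section \<open>Diagonal polynomials: bounds, continuity, homogeneity\<close>

definition diag_poly :: "(nat \<Rightarrow> complex) \<Rightarrow> nat \<Rightarrow> (nat \<Rightarrow> complex) \<Rightarrow> complex" where
  "diag_poly c K x = (\<Sum>n. c n * x n ^ K)"

context
  fixes p :: real and K :: nat and c :: "nat \<Rightarrow> complex"
  assumes p: "1 \<le> p" and K: "p \<le> real K" and c: "\<And>n. cmod (c n) \<le> 1"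
begin

lemma diag_poly_summable:
  assumes "x \<in> lp p"
  shows "summable (\<lambda>n. cmod (c n * x n ^ K))" "summable (\<lambda>n. c n * x n ^ K)"
proof -
  show "summable (\<lambda>n. cmod (c n * x n ^ K))"
    by (rule summable_comparison_test'[OF lp_power_sum(1)[OF p assms K]])
      (use c in \<open>auto simp: norm_mult norm_power intro: mult_left_le_one_le\<close>)
  then show "summable (\<lambda>n. c n * x n ^ K)"
    by (rule summable_norm_cancel)
qed

text \<open>The series of moduli stands between the two bounds because the strict estimate for the
  final polynomial compares this series, term by term, with the one without coefficients.\<close>

lemma norm_diag_poly_le:
  assumes "x \<in> lp p"
  shows "cmod (diag_poly c K x) \<le> (\<Sum>n. cmod (c n) * cmod (x n) ^ K)"
    and "(\<Sum>n. cmod (c n) * cmod (x n) ^ K) \<le> lp_norm p x ^ K"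
proof -
  have s: "summable (\<lambda>n. cmod (c n) * cmod (x n) ^ K)"
    using diag_poly_summable(1)[OF assms] by (simp add: norm_mult norm_power)
  show "cmod (diag_poly c K x) \<le> (\<Sum>n. cmod (c n) * cmod (x n) ^ K)"
    using summable_norm[OF diag_poly_summable(1)[OF assms]]
    by (simp add: diag_poly_def norm_mult norm_power)
  have "(\<Sum>n. cmod (c n) * cmod (x n) ^ K) \<le> (\<Sum>n. cmod (x n) ^ K)"
    using c by (intro suminf_le s lp_power_sum(1)[OF p assms K]) (auto intro: mult_left_le_one_le)
  also have "\<dots> \<le> lp_norm p x ^ K"
    by (rule lp_power_sum(2)[OF p assms K])
  finally show "(\<Sum>n. cmod (c n) * cmod (x n) ^ K) \<le> lp_norm p x ^ K" .
qed

text \<open>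
  Rescaling the difference \<open>x - y\<close> to norm \<open>1\<close> lets Young's inequality replace the
  Hoelder inequality.
\<close>

lemma diag_poly_diff_le:
  assumes x: "x \<in> lp p" and y: "y \<in> lp p"
  shows "cmod (diag_poly c K x - diag_poly c K y)
    \<le> real K * (lp_dist p x y * (1 + (lp_norm p x + lp_norm p y) ^ K))"
proof (cases "lp_dist p x y = 0")
  case True
  then have "x = y"
    using Metric_space.zero[OF Metric_space_lp[OF p] x y] by simp
  then show ?thesis using True by simp
next
  case False
  define s where "s = lp_dist p x y"
  have s: "s > 0"
    using False lp_norm_nonneg[of p] by (auto simp: s_def lp_dist_def less_le)
  obtain m where m: "K = Suc m"
    using p K by (cases K) auto
  define h where "h = (\<lambda>n. of_real (1 / s) * (x n - y n))"
  \<comment> \<open>The moduli are added as complex sequences so that \<open>u\<close> lies in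
    \<open>lp p\<close> and the triangle inequality bounds its norm.\<close>
  define u where "u = (\<lambda>n. complex_of_real (cmod (x n)) + of_real (cmod (y n)))"
  have h: "h \<in> lp p" "lp_norm p h = 1"
    unfolding h_def using lp_scale[OF p lp_diff[OF p x y], of "of_real (1 / s)"] s
    by (auto simp: s_def lp_dist_def norm_divide)
  have cx: "(\<lambda>n. complex_of_real (cmod (z n))) \<in> lp p"
    "lp_norm p (\<lambda>n. complex_of_real (cmod (z n))) = lp_norm p z" if "z \<in> lp p" for z
    using that by (auto simp: lp_def lp_norm_def)
  have u: "u \<in> lp p" "lp_norm p u \<le> lp_norm p x + lp_norm p y"
    unfolding u_def using lp_add[OF p cx(1)[OF x] cx(1)[OF y]] cx(2)[OF x] cx(2)[OF y] by auto
  have nu: "cmod (u n) = cmod (x n) + cmod (y n)" for n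
    unfolding u_def by (simp flip: of_real_add)
  define F where "F n = real K * (s * (cmod (h n) ^ K + cmod (u n) ^ K))" for n
  have le: "cmod (c n * x n ^ K - c n * y n ^ K) \<le> F n" for n
  proof -
    have "cmod (c n * x n ^ K - c n * y n ^ K) = cmod (c n) * cmod (x n ^ K - y n ^ K)"
      by (simp flip: norm_mult add: right_diff_distrib)
    also have "\<dots> \<le> cmod (x n ^ K - y n ^ K)"
      using c by (intro mult_left_le_one_le) auto
    also have "\<dots> \<le> real K * (cmod (x n - y n) * cmod (u n) ^ m)"
      using norm_power_diff_le[of "x n" m "y n"] by (simp only: m nu)
    also have "\<dots> = real K * (s * (cmod (h n) * cmod (u n) ^ m))"
      using s by (simp add: h_def norm_mult norm_divide)
    \<comment> \<open>Since \<open>K = m + 1\<close>, the product is at most the \<open>K\<close>-th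
      power of the larger of its two bases, hence at most the sum of both powers.\<close>
    also have "cmod (h n) * cmod (u n) ^ m \<le> cmod (h n) ^ K + cmod (u n) ^ K"
    proof (cases "cmod (h n) \<le> cmod (u n)")
      case True
      then have "cmod (h n) * cmod (u n) ^ m \<le> cmod (u n) * cmod (u n) ^ m"
        by (intro mult_right_mono) auto
      then show ?thesis by (simp add: m add_increasing)
    next
      case False
      then have "cmod (h n) * cmod (u n) ^ m \<le> cmod (h n) * cmod (h n) ^ m"
        by (intro mult_left_mono power_mono) auto
      then show ?thesis by (simp add: m add_increasing2)
    qed
    finally show ?thesis using s by (simp add: F_def mult_left_mono)
  qed
  note sh = lp_power_sum[OF p h(1) K] and su = lp_power_sum[OF p u(1) K]
  have F: "F sums (real K * (s * ((\<Sum>n. cmod (h n) ^ K) + (\<Sum>n. cmod (u n) ^ K))))"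
    unfolding F_def by (intro sums_mult sums_add summable_sums sh su)
  have sn: "summable (\<lambda>n. cmod (c n * x n ^ K - c n * y n ^ K))"
    by (rule summable_comparison_test'[OF sums_summable[OF F]]) (use le in auto)
  have "diag_poly c K x - diag_poly c K y = (\<Sum>n. c n * x n ^ K - c n * y n ^ K)"
    unfolding diag_poly_def by (intro suminf_diff diag_poly_summable x y)
  also have "cmod \<dots> \<le> (\<Sum>n. cmod (c n * x n ^ K - c n * y n ^ K))"
    by (rule summable_norm[OF sn])
  also have "\<dots> \<le> (\<Sum>n. F n)"
    by (rule suminf_le[OF le sn sums_summable[OF F]])
  also have "\<dots> = real K * (s * ((\<Sum>n. cmod (h n) ^ K) + (\<Sum>n. cmod (u n) ^ K)))"
    using sums_unique[OF F] by simp
  also have "\<dots> \<le> real K * (s * (1 + (lp_norm p x + lp_norm p y) ^ K))"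
  proof (intro mult_left_mono add_mono)
    show "(\<Sum>n. cmod (h n) ^ K) \<le> 1" using sh(2) h(2) by simp
    show "(\<Sum>n. cmod (u n) ^ K) \<le> (lp_norm p x + lp_norm p y) ^ K"
      using su(2) u(2) by (meson lp_norm_nonneg order_trans power_mono)
  qed (use s in auto)
  finally show ?thesis by (simp add: s_def)
qed

text \<open>The difference estimate is a Lipschitz bound on bounded sets, and continuity at
  \<open>x\<close> only concerns points at distance less than 1.\<close>

lemma continuous_map_diag_poly: "continuous_map (lp_topology p) euclidean (diag_poly c K)"
proof -
  interpret M: Metric_space "lp p" "lp_dist p" by (rule Metric_space_lp[OF p])
  have "\<exists>\<delta>>0. \<forall>y. y \<in> lp p \<and> lp_dist p x y < \<delta> \<longrightarrow> dist (diag_poly c K x) (diag_poly c K y) < \<epsilon>"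
    if x: "x \<in> lp p" and \<epsilon>: "\<epsilon> > 0" for x \<epsilon>
  proof -
    \<comment> \<open>The Lipschitz constant from the difference estimate, with
      \<open>lp_norm p y\<close> replaced by its bound \<open>lp_norm p x + 1\<close>; the last
      \<open>+ 1\<close> makes positivity immediate.\<close>
    define B where "B = real K * (1 + (lp_norm p x + (lp_norm p x + 1)) ^ K) + 1"
    have B: "B > 0"
      unfolding B_def using lp_norm_nonneg[of p x] by (intro add_nonneg_pos) auto
    have "dist (diag_poly c K x) (diag_poly c K y) < \<epsilon>"
      if y: "y \<in> lp p" and d: "lp_dist p x y < min 1 (\<epsilon> / B)" for y
    proof -
      have "lp_norm p y \<le> lp_norm p x + lp_norm p (\<lambda>n. y n - x n)"
        using lp_add(2)[OF p x lp_diff[OF p y x]] by simp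
      then have ny: "lp_norm p y \<le> lp_norm p x + 1"
        using d M.commute[of x y] by (simp add: lp_dist_def)
      have "cmod (diag_poly c K x - diag_poly c K y)
          \<le> lp_dist p x y * (real K * (1 + (lp_norm p x + lp_norm p y) ^ K))"
        using diag_poly_diff_le[OF x y] by (simp add: mult_ac)
      also have "\<dots> \<le> lp_dist p x y * (real K * (1 + (lp_norm p x + (lp_norm p x + 1)) ^ K))"
        using ny lp_norm_nonneg[of p x] lp_norm_nonneg[of p y] M.nonneg[of x y]
        by (intro mult_left_mono add_left_mono power_mono) auto
      also have "\<dots> \<le> lp_dist p x y * B"
        unfolding B_def using M.nonneg[of x y] by (intro mult_left_mono) auto
      also have "\<dots> < \<epsilon>"
        using d B by (simp add: pos_less_divide_eq)
      finally show ?thesis by (simp add: dist_norm)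
    qed
    then show ?thesis
      using \<epsilon> B by (intro exI[of _ "min 1 (\<epsilon> / B)"]) auto
  qed
  then have "continuous_map M.mtopology Met_TC.mtopology (diag_poly c K)"
    unfolding M.metric_continuous_map[OF Met_TC.Metric_space_axioms] by auto
  then show ?thesis
    by (simp add: lp_topology_def)
qed

text \<open>The polynomial is the restriction to the diagonal of the form \<open>L\<close>, which
  multiplies the \<open>n\<close>-th coordinates of its \<open>K\<close> arguments before summing
  against \<open>c\<close>.\<close>

lemma diag_poly_homog: "diag_poly c K \<in> homog_poly_lp p K"
proof -
  define L where "L X = (\<Sum>n. c n * (\<Prod>i<K. X i n))" for X :: "nat \<Rightarrow> nat \<Rightarrow> complex"
  have K0: "0 < K" using p K by (cases K) auto
  \<comment> \<open>Linearity of \<open>suminf\<close> holds for convergent series, so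
    \<open>L\<close> must first be shown to converge on every tuple from
    \<open>lp p\<close>.\<close>
  have summ: "summable (\<lambda>n. c n * (\<Prod>i<K. X i n))" if "\<And>i. i < K \<Longrightarrow> X i \<in> lp p" for X
  proof (rule summable_comparison_test')
    show "summable (\<lambda>n. \<Sum>i<K. cmod (X i n) ^ K)"
      using that by (intro summable_sum lp_power_sum(1)[OF p _ K]) auto
    show "norm (c n * (\<Prod>i<K. X i n)) \<le> (\<Sum>i<K. cmod (X i n) ^ K)" for n
    proof -
      have "norm (c n * (\<Prod>i<K. X i n)) \<le> (\<Prod>i<K. cmod (X i n))"
        using c by (auto simp: norm_mult prod_norm[symmetric] intro!: mult_left_le_one_le prod_nonneg)
      also have "\<dots> \<le> (\<Sum>i<K. cmod (X i n) ^ K)"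
        using K0 by (intro prod_le_sum_power) auto
      finally show ?thesis .
    qed
  qed
  have "multilinear_lp p K L"
    unfolding multilinear_lp_def
  proof (intro ballI allI impI)
    fix X i y z and a b :: complex
    assume X: "X \<in> {..<K} \<rightarrow>\<^sub>E lp p" and i: "i < K" and y: "y \<in> lp p" and z: "z \<in> lp p"
    have su: "summable (\<lambda>n. c n * (\<Prod>j<K. (X(i := w)) j n))" if "w \<in> lp p" for w
      using X that by (intro summ) auto
    \<comment> \<open>Isolating the factor of slot \<open>i\<close> makes each term visibly linear
      in that slot; the remaining product does not depend on \<open>w\<close>.\<close>
    have split: "(\<Prod>j<K. (X(i := w)) j n) = w n * (\<Prod>j\<in>{..<K} - {i}. X j n)" for w n
      using i by (subst prod.remove[of _ i]) auto
    have "L (X(i := (\<lambda>n. a * y n + b * z n)))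
        = (\<Sum>n. a * (c n * (\<Prod>j<K. (X(i := y)) j n)) + b * (c n * (\<Prod>j<K. (X(i := z)) j n)))"
      unfolding L_def split by (simp add: algebra_simps)
    also have "\<dots> = a * L (X(i := y)) + b * L (X(i := z))"
      unfolding L_def using su[OF y] su[OF z]
      by (subst suminf_add[symmetric]) (auto intro: summable_mult simp del: fun_upd_apply simp: suminf_mult)
    finally show "L (X(i := (\<lambda>n. a * y n + b * z n))) = a * L (X(i := y)) + b * L (X(i := z))" .
  qed
  moreover have "diag_poly c K x = L (\<lambda>i\<in>{..<K}. x)" for x
    by (simp add: L_def diag_poly_def)
  ultimately show ?thesis
    using continuous_map_diag_poly by (auto simp: homog_poly_lp_def)
qed

end

section \<open>Constant, zero and homogeneous polynomials at the origin\<close>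

lemma const_homog_poly_lp: "(\<lambda>_. a) \<in> homog_poly_lp p 0"
  unfolding homog_poly_lp_def multilinear_lp_def
  by (intro CollectI conjI exI[of _ "\<lambda>_. a"]) auto

lemma zero_homog_poly_lp: "(\<lambda>_. 0) \<in> homog_poly_lp p m"
  unfolding homog_poly_lp_def multilinear_lp_def
  by (intro CollectI conjI exI[of _ "\<lambda>_. 0"]) auto

lemma zero_in_lp: "(\<lambda>_. 0) \<in> lp p"
  by (simp add: lp_def)

lemma lp_norm_zero: "lp_norm p (\<lambda>_. 0) = 0"
  by (simp add: lp_norm_def)

text \<open>Linearity in slot 0 with both coefficients zero kills the form on the zero tuple. This
  rules out positive degrees for a polynomial with nonzero constant term.\<close>

lemma homog_poly_lp_zero:
  assumes "P \<in> homog_poly_lp p m" "0 < m"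
  shows "P (\<lambda>_. 0) = 0"
proof -
  obtain L where L: "multilinear_lp p m L" "\<forall>x \<in> lp p. P x = L (\<lambda>i\<in>{..<m}. x)"
    using assms(1) by (auto simp: homog_poly_lp_def)
  define X where "X = (\<lambda>i\<in>{..<m}. (\<lambda>_. 0) :: nat \<Rightarrow> complex)"
  have "X \<in> {..<m} \<rightarrow>\<^sub>E lp p"
    by (auto simp: X_def zero_in_lp)
  then have "L (X(0 := (\<lambda>n. a * 0 + b * 0))) = a * L (X(0 := (\<lambda>_. 0))) + b * L (X(0 := (\<lambda>_. 0)))"
    for a b
    using L(1)[unfolded multilinear_lp_def, rule_format, OF _ assms(2) zero_in_lp zero_in_lp] by metis
  from this[of 0 0] have "L (X(0 := (\<lambda>_. 0))) = 0" by simp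
  moreover have "X(0 := (\<lambda>_. 0)) = X"
    using assms(2) by (auto simp: X_def)
  ultimately show ?thesis
    using L(2) zero_in_lp by (simp add: X_def)
qed

text \<open>All vectors give the same empty tuple. This rules out degree 0 for a nonconstant
  polynomial.\<close>

lemma homog_poly_lp_0_const:
  assumes "P \<in> homog_poly_lp p 0" "x \<in> lp p" "y \<in> lp p"
  shows "P x = P y"
proof -
  have "(\<lambda>i\<in>{..<0::nat}. x) = (\<lambda>i\<in>{..<0}. y)" by auto
  then show ?thesis using assms by (auto simp: homog_poly_lp_def)
qed

section \<open>Multiples of the unit vectors\<close>

definition single :: "nat \<Rightarrow> complex \<Rightarrow> nat \<Rightarrow> complex" where
  "single n t = (\<lambda>i. if i = n then t else 0)"

lemma single_sums: "(\<lambda>i. cmod (single n t i) powr p) sums (cmod t powr p)"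
proof -
  have "(\<lambda>i. cmod (single n t i) powr p) = (\<lambda>i. if i = n then cmod t powr p else 0)"
    by (auto simp: single_def)
  then show ?thesis
    using sums_single[of n "\<lambda>_. cmod t powr p"] by simp
qed

lemma single_in_lp: "single n t \<in> lp p"
  using sums_summable[OF single_sums] by (simp add: lp_def)

lemma lp_norm_single: "1 \<le> p \<Longrightarrow> lp_norm p (single n t) = cmod t"
  unfolding lp_norm_def sums_unique[OF single_sums, symmetric] by (simp add: powr_powr)

lemma diag_poly_single: "0 < K \<Longrightarrow> diag_poly c K (single n t) = c n * t ^ K"
proof -
  assume "0 < K"
  \<comment> \<open>Positivity of \<open>K\<close> matters: with \<open>0 ^ 0 = 1\<close> the zero
    coordinates would contribute \<open>c i\<close>.\<close>
  then have "(\<lambda>i. c i * single n t i ^ K) = (\<lambda>i. if i = n then c n * t ^ K else 0)"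
    by (auto simp: single_def)
  then show ?thesis
    using sums_unique[OF sums_single[of n "\<lambda>_. c n * t ^ K"]] by (simp add: diag_poly_def)
qed

section \<open>The polynomial \<open>1 + D\<close>: weighted norm attained, supremum norm not
  attained\<close>

theorem proposition2p10:
  fixes p :: real and k :: nat
  assumes "1 \<le> p" and "p \<le> real k"
  shows "\<exists>P \<in> poly_lp p (k + 1).
    (\<forall>m. P \<notin> homog_poly_lp p m) \<and> P \<in> NA_v p (k + 1) \<and> P \<notin> NA p (k + 1)"
proof -
  define K where "K = k + 1"
  \<comment> \<open>Any coefficients below 1 in modulus with supremum 1 would serve the idea; these
    tend to 1 explicitly.\<close>
  define c :: "nat \<Rightarrow> complex" where "c n = of_real (real n / real (Suc n))" for n
  define D where "D = diag_poly c K"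
  define P where "P x = 1 + D x" for x
  note p = assms(1)
  \<comment> \<open>The bound \<open>2 \<le> K\<close>, from \<open>1 \<le> p\<close> and
    \<open>p \<le> k\<close>, is what later gives \<open>r ^ K \<le> r\<^sup>2\<close>.\<close>
  have K: "p \<le> real K" "2 \<le> K" using assms by (auto simp: K_def)
  have cn: "cmod (c n) = real n / real (Suc n)" for n
    unfolding c_def norm_of_real by simp
  have c1: "cmod (c n) < 1" for n by (simp add: cn)
  have c: "cmod (c n) \<le> 1" for n using c1 less_imp_le by blast
  note D_le = norm_diag_poly_le[of p K c, OF p K(1) c, folded D_def]
  have D0: "D (\<lambda>_. 0) = 0"
    using K by (simp add: D_def diag_poly_def power_0_left)
  have Ds: "D (single n t) = c n * t ^ K" for n t
    using K by (simp add: D_def diag_poly_single)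
  have "P \<in> poly_lp p K"
    unfolding poly_lp_def
  proof (intro CollectI exI conjI allI impI ballI)
    let ?Q = "\<lambda>m. if m = 0 then (\<lambda>_. 1) else if m = K then D else (\<lambda>_. 0)"
    show "?Q m \<in> homog_poly_lp p m" for m
      using const_homog_poly_lp zero_homog_poly_lp diag_poly_homog[of p K c, OF p K(1) c]
      by (auto simp: D_def)
    show "P x = (\<Sum>m\<le>K. ?Q m x)" for x
    proof -
      have "(\<Sum>m\<le>K. ?Q m x) = (\<Sum>m\<in>{0, K}. ?Q m x)"
        by (rule sum.mono_neutral_right) auto
      then show ?thesis using K by (simp add: P_def)
    qed
  qed
  moreover have "P \<notin> homog_poly_lp p m" for m
  proof
    assume P: "P \<in> homog_poly_lp p m"
    then have "m = 0"
      using homog_poly_lp_zero[of P p m] by (auto simp: P_def D0)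
    \<comment> \<open>Degree 0 would make \<open>P\<close> constant, but its value is 3/2 here and 1
      at the origin. Index 1 is used because \<open>c 0 = 0\<close>.\<close>
    then have "P (single 1 1) = P (\<lambda>_. 0)"
      using P homog_poly_lp_0_const single_in_lp zero_in_lp by blast
    then show False by (simp add: P_def Ds D0 c_def)
  qed
  moreover have "(1 - (lp_norm p z)\<^sup>2) * cmod (P z) = v_norm p P" if z: "z = (\<lambda>_. 0)" for z
  proof -
    have "(1 - (lp_norm p x)\<^sup>2) * cmod (P x) \<le> 1" if "x \<in> lp_ball p" for x
    proof -
      define r where "r = lp_norm p x"
      have r: "0 \<le> r" "r < 1" and x: "x \<in> lp p"
        using that by (auto simp: lp_ball_def r_def lp_norm_nonneg)
      have "cmod (P x) \<le> 1 + cmod (D x)"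
        unfolding P_def by (rule norm_triangle_le) simp
      also have "cmod (D x) \<le> r ^ K"
        unfolding r_def by (rule order_trans[OF D_le[OF x]])
      also have "r ^ K \<le> r\<^sup>2"
        using r K by (intro power_decreasing) auto
      finally have "(1 - r\<^sup>2) * cmod (P x) \<le> (1 - r\<^sup>2) * (1 + r\<^sup>2)"
        using r by (intro mult_left_mono) (auto simp: power_le_one)
      also have "\<dots> = 1 - r ^ 4" by (simp add: algebra_simps flip: power_add)
      also have "\<dots> \<le> 1" using r by simp
      finally show ?thesis by (simp add: r_def)
    qed
    then have "v_norm p P = 1"
      unfolding v_norm_def
      by (intro cSup_eq_maximum)
        (auto intro!: image_eqI[of _ _ "\<lambda>_. 0"] simp: lp_ball_def zero_in_lp lp_norm_zero P_def D0)
    then show ?thesis by (simp add: z lp_norm_zero P_def D0)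
  qed
  then have "\<exists>z\<in>lp_cball p. (1 - (lp_norm p z)\<^sup>2) * cmod (P z) = v_norm p P"
    by (intro bexI[of _ "\<lambda>_. 0"]) (auto simp: lp_cball_def zero_in_lp lp_norm_zero)
  moreover have "cmod (P x) < sup_norm p P" if "x \<in> lp_cball p" for x
  proof -
    \<comment> \<open>Non-attainment follows from two facts: the modulus stays strictly below 2 on
      the whole closed ball, while the supremum over the open ball is at least 2.\<close>
    have less: "cmod (P x) < 2" if "x \<in> lp_cball p" for x
    proof -
      have x: "x \<in> lp p" and r: "lp_norm p x \<le> 1"
        using that by (auto simp: lp_cball_def)
      show ?thesis
      proof (cases "\<forall>n. x n = 0")
        case True
        then have "x = (\<lambda>_. 0)" by auto
        then show ?thesis by (simp add: P_def D0)
      next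
        case False
        then obtain j where j: "x j \<noteq> 0" by auto
        have s: "summable (\<lambda>n. cmod (c n) * cmod (x n) ^ K)"
          using diag_poly_summable(1)[of p K c, OF p K(1) c x] by (simp add: norm_mult norm_power)
        note sx = lp_power_sum[OF p x K(1)]
        \<comment> \<open>Termwise strictness passes to the sums: all differences are nonnegative,
          and the one at the nonzero coordinate \<open>j\<close> is positive.\<close>
        have "0 < (\<Sum>n. cmod (x n) ^ K - cmod (c n) * cmod (x n) ^ K)"
        proof (rule suminf_pos2)
          show "summable (\<lambda>n. cmod (x n) ^ K - cmod (c n) * cmod (x n) ^ K)"
            by (intro summable_diff sx s)
          show "0 \<le> cmod (x n) ^ K - cmod (c n) * cmod (x n) ^ K" for n
            using c[of n] by (simp add: mult_left_le_one_le)
          show "0 < cmod (x j) ^ K - cmod (c j) * cmod (x j) ^ K"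
            using c1[of j] j by simp
        qed
        then have "(\<Sum>n. cmod (c n) * cmod (x n) ^ K) < (\<Sum>n. cmod (x n) ^ K)"
          using suminf_diff[OF sx(1) s] by simp
        then have "cmod (D x) < 1"
          using D_le(1)[OF x] sx(2) power_le_one[OF lp_norm_nonneg r, of K] by linarith
        then show ?thesis
          unfolding P_def using norm_triangle_ineq[of 1 "D x"] by simp
      qed
    qed
    have bdd: "bdd_above ((\<lambda>x. cmod (P x)) ` lp_ball p)"
      using less by (intro bdd_aboveI[of _ 2]) (force simp: lp_ball_def lp_cball_def)
    have lower: "1 + real n / real (Suc n) * t ^ K \<le> sup_norm p P" if t: "0 < t" "t < 1" for n t
    proof -
      have "P (single n (of_real t)) = of_real (1 + real n / real (Suc n) * t ^ K)"
        by (simp add: P_def Ds c_def)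
      then have "cmod (P (single n (of_real t))) = 1 + real n / real (Suc n) * t ^ K"
        using t by (simp only: norm_of_real) simp
      moreover have "single n (of_real t) \<in> lp_ball p"
        using t by (simp add: lp_ball_def single_in_lp lp_norm_single[OF p])
      ultimately show ?thesis
        unfolding sup_norm_def using cSUP_upper[OF _ bdd] by metis
    qed
    \<comment> \<open>Two successive limits: first \<open>t\<close> tends to 1 from the left with
      \<open>n\<close> fixed, since unit vectors are not in the open ball, then \<open>n\<close>
      tends to infinity.\<close>
    have "1 + real n / real (Suc n) \<le> sup_norm p P" for n
    proof (rule tendsto_upperbound)
      show "((\<lambda>t. 1 + real n / real (Suc n) * t ^ K) \<longlongrightarrow> 1 + real n / real (Suc n)) (at_left 1)"
        by (auto intro!: tendsto_eq_intros)
      show "\<forall>\<^sub>F t in at_left 1. 1 + real n / real (Suc n) * t ^ K \<le> sup_norm p P"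
        by (rule eventually_mono[OF eventually_at_left_real[of 0 1]]) (use lower in auto)
    qed auto
    moreover have "(\<lambda>n. 1 + real n / real (Suc n)) \<longlonglongrightarrow> 1 + 1"
      by (intro tendsto_add tendsto_const LIMSEQ_n_over_Suc_n)
    ultimately have "2 \<le> sup_norm p P"
      by (intro LIMSEQ_le_const2[of _ "2"]) auto
    then show ?thesis using less[OF that] by linarith
  qed
  then have "P \<notin> NA p K"
    by (fastforce simp: NA_def)
  ultimately show ?thesis
    unfolding K_def[symmetric] by (intro bexI[of _ P]) (auto simp: NA_v_def)
qed

end
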